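(* All epimorphisms $$G_3\twoheadrightarrow G_0\twoheadrightarrow\mathbb{B}_3/(\sigma_1\sigma_2)^3,\qquad G_2',\,G_2''\twoheadrightarrow\mathbb{B}_3/(\sigma_1\sigma_2)^3$$ induced by the respective perturbations of the curves (plane sextics of torus type with at least two type $\mathbf{E}_6$ singular points having these groups as fundamental groups of their complements) are proper, i.e., they are not isomorphisms.
   Context: A plane sextic $B\subset\mathbb{P}^2$ (reduced complex curve of degree $6$) is of torus type if its equation can be written as $p^3+q^2=0$ with $p,q$ homogeneous of degree $2$ and $3$. A singular point is inner if it lies in $\{p=0\}\cap\{q=0\}$; in a set of singularities the inner ones are enclosed in parentheses. The groups in question are the fundamental groups $\pi_1(\mathbb{P}^2\setminus B)$ of sextics of torus type with at least two type $\mathbf{E}_6$ singular points: it is $G_3$ for the set of singularities $(2\mathbf{E}_6\oplus2\mathbf{A}_2)\oplus\mathbf{A}_3$; it is $G_0$ for $(3\mathbf{E}_6)\oplus\mathbf{A}_1$ and $(2\mathbf{E}_6\oplus2\mathbf{A}_2)\oplus2\mathbf{A}_1$; it is $G_2'$ or $G_2''$ for the two sextics (up to projective transformation) with the set of singularities $(2\mathbf{E}_6\oplus\mathbf{A}_5)\oplus\mathbf{A}_2$; and it is $\mathbb{B}_3/(\sigma_1\sigma_2)^3$ for $(3\mathbf{E}_6)$, $(2\mathbf{E}_6\oplus\mathbf{A}_5)\oplus\mathbf{A}_1$, $(2\mathbf{E}_6\oplus\mathbf{A}_5)$, $(2\mathbf{E}_6\oplus2\mathbf{A}_2)\oplus\mathbf{A}_2$,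 $(2\mathbf{E}_6\oplus2\mathbf{A}_2)\oplus\mathbf{A}_1$, $(2\mathbf{E}_6\oplus2\mathbf{A}_2)$. If a sextic $B'$ is a small perturbation of a sextic $B$, and $T$ is a regular neighborhood of $B$ containing $B'$, then the composition $\pi_1(\mathbb{P}^2\setminus B)\cong\pi_1(\mathbb{P}^2\setminus T)\to\pi_1(\mathbb{P}^2\setminus B')$, where the second map is induced by inclusion, is an epimorphism (Zariski); it takes meridians of $B$ to meridians of $B'$. This is the epimorphism induced by the perturbation. $\mathbb{B}_n$ is the braid group on $n$ strings with Artin generators $\sigma_1,\dots,\sigma_{n-1}$, and $\mathbb{B}_n/w$ is the quotient by the normal closure of $w$. $G_0=\mathbb{B}_4/\sigma_2\sigma_1^2\sigma_2\sigma_3^2$. $$G_3=\bigl\langle\alpha,\beta,\bar\beta\bigm|\alpha\beta\alpha=\beta\alpha\beta,\ \alpha\bar\beta\alpha=\bar\beta\alpha\bar\beta,\ \beta\alpha^{-1}\bar\beta\beta\bar\beta^{-1}\alpha\beta^{-1}=\bar\beta\alpha^{-1}\beta\bar\beta\beta^{-1}\alpha\bar\beta^{-1},$$ $$(\bar\beta\beta)^2=(\beta\bar\beta)^2,\ \alpha\bar\beta\beta\bar\beta\beta^{-1}\alpha\beta\bar\beta\beta\bar\beta^{-1}=1\bigr\rangle.$$ In the next two presentations, $\bar\alpha$ and $\bar\beta$ stand for the words $\bar\alpha=(\alpha\beta)^{-1}\beta(\alpha\beta)$ and $\bar\beta=(\alpha\beta)\alpha(\alpha\beta)^{-1}$: $$G_2'=\bigl\langle\alpha,\beta\bigm|(\alpha\beta)^3=(\beta\alpha)^3,\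 \bar\beta\beta\bar\beta=\beta\bar\beta\beta,\ \alpha\bar\beta\beta\bar\alpha\beta\bar\beta=1,\ \alpha^{-1}\beta\bar\beta\beta^{-1}\alpha=\bar\alpha^{-1}\bar\beta\beta\bar\beta^{-1}\bar\alpha\bigr\rangle,$$ $$G_2''=\bigl\langle\alpha,\beta,\gamma,\bar\gamma\bigm|(\alpha\beta)^3=(\beta\alpha)^3,\ \alpha\beta\bar\gamma\alpha\beta\gamma=1,\ \gamma\bar\gamma\gamma=\bar\gamma\gamma\bar\gamma,\ \bar\gamma\gamma\bar\gamma^{-1}=\beta,\ \gamma\bar\gamma\gamma^{-1}=\bar\beta,\ \gamma\alpha\gamma^{-1}=\bar\gamma\bar\alpha\bar\gamma^{-1}\bigr\rangle.$$ *)

theory Defs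
  imports "HOL-Analysis.Analysis" "HOL-Algebra.Coset"
begin

section \<open>Finitely presented groups\<close>

text \<open>A letter \<open>(a, True)\<close> is the generator \<open>a\<close>, a letter \<open>(a, False)\<close> its inverse.\<close>

type_synonym 'a word = "('a \<times> bool) list"

definition gen :: "'a \<Rightarrow> 'a word" where
  "gen a = [(a, True)]"

definition winv :: "'a word \<Rightarrow> 'a word" where
  "winv w = rev (map (\<lambda>(a, s). (a, \<not> s)) w)"

definition wpow :: "'a word \<Rightarrow> nat \<Rightarrow> 'a word" where
  "wpow w n = concat (replicate n w)"

text \<open>A relation \<open>u = v\<close> of a presentation is the pair \<open>(u, v)\<close>.  The group presented by the
  generators \<open>X\<close> and the relations \<open>R\<close> is the set of words modulo the congruence generated by
  free cancellation and \<open>R\<close>.\<close>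

inductive pres_eq :: "'a set \<Rightarrow> ('a word \<times> 'a word) set \<Rightarrow> 'a word \<Rightarrow> 'a word \<Rightarrow> bool"
  for X R where
  refl: "w \<in> lists (X \<times> UNIV) \<Longrightarrow> pres_eq X R w w"
| sym: "pres_eq X R u v \<Longrightarrow> pres_eq X R v u"
| trans: "pres_eq X R u v \<Longrightarrow> pres_eq X R v w \<Longrightarrow> pres_eq X R u w"
| append: "pres_eq X R u u' \<Longrightarrow> pres_eq X R v v' \<Longrightarrow> pres_eq X R (u @ v) (u' @ v')"
| cancel: "a \<in> X \<Longrightarrow> pres_eq X R [(a, s), (a, \<not> s)] []"
| relation: "(u, v) \<in> R \<Longrightarrow> pres_eq X R u v"

definition word_class :: "'a set \<Rightarrow> ('a word \<times> 'a word) set \<Rightarrow> 'a word \<Rightarrow> 'a word set" where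
  "word_class X R w = {v. pres_eq X R w v}"

definition presented_group :: "'a set \<Rightarrow> ('a word \<times> 'a word) set \<Rightarrow> 'a word set monoid" where
  "presented_group X R =
     \<lparr>carrier = word_class X R ` lists (X \<times> UNIV),
      monoid.mult = (\<lambda>A B. \<Union>u\<in>A. \<Union>v\<in>B. word_class X R (u @ v)),
      one = word_class X R []\<rparr>"

section \<open>Braid groups and their quotients\<close>

definition braid_relations :: "nat \<Rightarrow> (nat word \<times> nat word) set" where
  "braid_relations n =
     {(gen i @ gen j, gen j @ gen i) | i j. i \<in> {1..<n} \<and> j \<in> {1..<n} \<and> i + 2 \<le> j} \<union>
     {(gen i @ gen (i + 1) @ gen i, gen (i + 1) @ gen i @ gen (i + 1)) | i.
        i \<in> {1..<n} \<and> i + 1 \<in> {1..<n}}"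

definition braid_group :: "nat \<Rightarrow> nat word set monoid" where
  "braid_group n = presented_group {1..<n} (braid_relations n)"

definition normal_closure :: "('a, 'b) monoid_scheme \<Rightarrow> 'a set \<Rightarrow> 'a set" where
  "normal_closure G A = \<Inter>{N. N \<lhd> G \<and> A \<subseteq> N}"

definition braid_quotient :: "nat \<Rightarrow> nat word \<Rightarrow> nat word set set monoid" where
  "braid_quotient n w =
     braid_group n Mod normal_closure (braid_group n) {word_class {1..<n} (braid_relations n) w}"

definition B3_quotient :: "nat word set set monoid" where
  "B3_quotient = braid_quotient 3 (wpow (gen 1 @ gen 2) 3)"

definition G0 :: "nat word set set monoid" where
  "G0 = braid_quotient 4 (gen 2 @ gen 1 @ gen 1 @ gen 2 @ gen 3 @ gen 3)"

section \<open>The groups G3, G2' and G2''\<close>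

definition G3 :: "nat word set monoid" where
  "G3 =
    (let \<alpha> = gen 0; \<beta> = gen 1; \<beta>b = gen 2 in
     presented_group {0, 1, 2}
      {(\<alpha> @ \<beta> @ \<alpha>, \<beta> @ \<alpha> @ \<beta>),
       (\<alpha> @ \<beta>b @ \<alpha>, \<beta>b @ \<alpha> @ \<beta>b),
       (\<beta> @ winv \<alpha> @ \<beta>b @ \<beta> @ winv \<beta>b @ \<alpha> @ winv \<beta>,
        \<beta>b @ winv \<alpha> @ \<beta> @ \<beta>b @ winv \<beta> @ \<alpha> @ winv \<beta>b),
       (wpow (\<beta>b @ \<beta>) 2, wpow (\<beta> @ \<beta>b) 2),
       (\<alpha> @ \<beta>b @ \<beta> @ \<beta>b @ winv \<beta> @ \<alpha> @ \<beta> @ \<beta>b @ \<beta> @ winv \<beta>b, [])})"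

definition G2' :: "nat word set monoid" where
  "G2' =
    (let \<alpha> = gen 0; \<beta> = gen 1;
         \<alpha>b = winv (\<alpha> @ \<beta>) @ \<beta> @ (\<alpha> @ \<beta>);
         \<beta>b = (\<alpha> @ \<beta>) @ \<alpha> @ winv (\<alpha> @ \<beta>) in
     presented_group {0, 1}
      {(wpow (\<alpha> @ \<beta>) 3, wpow (\<beta> @ \<alpha>) 3),
       (\<beta>b @ \<beta> @ \<beta>b, \<beta> @ \<beta>b @ \<beta>),
       (\<alpha> @ \<beta>b @ \<beta> @ \<alpha>b @ \<beta> @ \<beta>b, []),
       (winv \<alpha> @ \<beta> @ \<beta>b @ winv \<beta> @ \<alpha>, winv \<alpha>b @ \<beta>b @ \<beta> @ winv \<beta>b @ \<alpha>b)})"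

definition G2'' :: "nat word set monoid" where
  "G2'' =
    (let \<alpha> = gen 0; \<beta> = gen 1; \<gamma> = gen 2; \<gamma>b = gen 3;
         \<alpha>b = winv (\<alpha> @ \<beta>) @ \<beta> @ (\<alpha> @ \<beta>);
         \<beta>b = (\<alpha> @ \<beta>) @ \<alpha> @ winv (\<alpha> @ \<beta>) in
     presented_group {0, 1, 2, 3}
      {(wpow (\<alpha> @ \<beta>) 3, wpow (\<beta> @ \<alpha>) 3),
       (\<alpha> @ \<beta> @ \<gamma>b @ \<alpha> @ \<beta> @ \<gamma>, []),
       (\<gamma> @ \<gamma>b @ \<gamma>, \<gamma>b @ \<gamma> @ \<gamma>b),
       (\<gamma>b @ \<gamma> @ winv \<gamma>b, \<beta>),
       (\<gamma> @ \<gamma>b @ winv \<gamma>, \<beta>b),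
       (\<gamma> @ \<alpha> @ winv \<gamma>, \<gamma>b @ \<alpha>b @ winv \<gamma>b)})"

section \<open>The complex projective plane\<close>

definition proportional :: "complex^3 \<Rightarrow> complex^3 \<Rightarrow> bool" where
  "proportional v w \<longleftrightarrow> v \<noteq> 0 \<and> w \<noteq> 0 \<and> (\<exists>c. w = c *s v)"

lemma part_equivp_proportional: "part_equivp proportional"
proof (rule part_equivpI)
  show "\<exists>v. proportional v v"
  proof
    have "axis 1 1 = (1 :: complex) *s (axis 1 1 :: complex^3)" by simp
    then show "proportional (axis 1 1) (axis 1 1)"
      unfolding proportional_def by (metis axis_eq_0_iff zero_neq_one)
  qed
  show "symp proportional"
  proof (rule sympI)
    fix v w assume "proportional v w"
    then obtain c where c: "v \<noteq> 0" "w \<noteq> 0" "w = c *s v"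
      by (auto simp: proportional_def)
    then have "c \<noteq> 0" by auto
    with c have "v = inverse c *s w" by (simp add: vector_smult_assoc)
    with c(1,2) show "proportional w v" unfolding proportional_def by blast
  qed
  show "transp proportional"
    unfolding transp_def proportional_def by (metis vector_smult_assoc)
qed

quotient_type cp2 = "complex^3" / partial: proportional
  by (rule part_equivp_proportional)

instantiation cp2 :: topological_space
begin

definition open_cp2 :: "cp2 set \<Rightarrow> bool" where
  "open_cp2 U \<longleftrightarrow> open {v. v \<noteq> 0 \<and> abs_cp2 v \<in> U}"

instance
proof
  have eq: "{v. v \<noteq> (0 :: complex^3) \<and> abs_cp2 v \<in> UNIV} = - {0}" by auto
  show "open (UNIV :: cp2 set)"
    unfolding open_cp2_def eq by auto
next
  fix S T :: "cp2 set" assume "open S" "open T"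
  moreover have "{v. v \<noteq> 0 \<and> abs_cp2 v \<in> S \<inter> T} =
      {v. v \<noteq> 0 \<and> abs_cp2 v \<in> S} \<inter> {v. v \<noteq> 0 \<and> abs_cp2 v \<in> T}" by auto
  ultimately show "open (S \<inter> T)" by (simp add: open_cp2_def open_Int)
next
  fix K :: "cp2 set set" assume "\<forall>S\<in>K. open S"
  moreover have "{v. v \<noteq> 0 \<and> abs_cp2 v \<in> \<Union>K} = (\<Union>S\<in>K. {v. v \<noteq> 0 \<and> abs_cp2 v \<in> S})" by auto
  ultimately show "open (\<Union>K)" unfolding open_cp2_def by auto
qed

end

section \<open>Plane sextics of torus type\<close>

text \<open>Homogeneous polynomials are represented by the polynomial functions they define.\<close>

definition is_form :: "nat \<Rightarrow> (complex^3 \<Rightarrow> complex) \<Rightarrow> bool" where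
  "is_form d F \<longleftrightarrow> (\<exists>c :: nat \<times> nat \<times> nat \<Rightarrow> complex.
     F = (\<lambda>v. \<Sum>(i, j, k) \<in> {(i, j, k). i + j + k = d}. c (i, j, k) * v$1 ^ i * v$2 ^ j * v$3 ^ k))"

definition curve :: "(complex^3 \<Rightarrow> complex) \<Rightarrow> cp2 set" where
  "curve F = {abs_cp2 v | v. v \<noteq> 0 \<and> F v = 0}"

text \<open>A reduced sextic is given by a form with no multiple factor; this excludes \<open>F = 0\<close>.\<close>

definition plane_sextic :: "(complex^3 \<Rightarrow> complex) \<Rightarrow> bool" where
  "plane_sextic F \<longleftrightarrow> is_form 6 F \<and>
     \<not> (\<exists>d e G H. d > 0 \<and> 2 * d + e = 6 \<and> is_form d G \<and> is_form e H \<and> F = (\<lambda>v. G v ^ 2 * H v))"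

definition torus_type :: "(complex^3 \<Rightarrow> complex) \<Rightarrow> bool" where
  "torus_type F \<longleftrightarrow> (\<exists>p q. is_form 2 p \<and> is_form 3 q \<and> F = (\<lambda>v. p v ^ 3 + q v ^ 2))"

definition holomorphic_near :: "(complex^'m \<Rightarrow> complex^'n) \<Rightarrow> complex^'m \<Rightarrow> bool" where
  "holomorphic_near f a \<longleftrightarrow>
     (\<forall>\<^sub>F w in nhds a. \<exists>D. (f has_derivative D) (at w) \<and> Vector_Spaces.linear (*s) (*s) D)"

text \<open>The curve \<open>F = 0\<close> has a type E6 point at \<open>P\<close> if in suitable local analytic coordinates
  \<open>(x, y)\<close> of the plane centred at \<open>P\<close> its local equation is \<open>x\<^sup>3 + y\<^sup>4\<close>. The coordinates are given
  by their inverse, a holomorphic germ \<open>\<psi>\<close> to the cone over the plane; the condition on the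
  derivative says that the composition of \<open>\<psi>\<close> with the projection is a local isomorphism.\<close>

definition type_E6_point :: "(complex^3 \<Rightarrow> complex) \<Rightarrow> cp2 \<Rightarrow> bool" where
  "type_E6_point F P \<longleftrightarrow> (\<exists>(\<psi> :: complex^2 \<Rightarrow> complex^3) D.
     holomorphic_near \<psi> 0 \<and> \<psi> 0 \<noteq> 0 \<and> abs_cp2 (\<psi> 0) = P \<and>
     (\<psi> has_derivative D) (at 0) \<and> (\<forall>c w. c *s \<psi> 0 + D w = 0 \<longrightarrow> w = 0) \<and>
     (\<forall>\<^sub>F w in nhds 0. F (\<psi> w) = w$1 ^ 3 + w$2 ^ 4))"

definition torus_sextic_2E6 :: "(complex^3 \<Rightarrow> complex) \<Rightarrow> bool" where
  "torus_sextic_2E6 F \<longleftrightarrow> plane_sextic F \<and> torus_type F \<and>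
     (\<exists>P Q. P \<noteq> Q \<and> type_E6_point F P \<and> type_E6_point F Q)"

section \<open>Fundamental groups\<close>

definition loops :: "'a::topological_space set \<Rightarrow> 'a \<Rightarrow> (real \<Rightarrow> 'a) set" where
  "loops S x = {p. path p \<and> path_image p \<subseteq> S \<and> pathstart p = x \<and> pathfinish p = x}"

definition loop_class :: "'a::topological_space set \<Rightarrow> (real \<Rightarrow> 'a) \<Rightarrow> (real \<Rightarrow> 'a) set" where
  "loop_class S p = {q. homotopic_paths S p q}"

definition fundamental_group ::
    "'a::topological_space set \<Rightarrow> 'a \<Rightarrow> (real \<Rightarrow> 'a) set monoid" where
  "fundamental_group S x =
     \<lparr>carrier = loop_class S ` loops S x,
      monoid.mult = (\<lambda>A B. \<Union>p\<in>A. \<Union>q\<in>B. loop_class S (p +++ q)),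
      one = loop_class S (\<lambda>_. x)\<rparr>"

text \<open>The homomorphism of fundamental groups induced by the inclusion of a space in \<open>S\<close>.\<close>

definition inclusion_hom ::
    "'a::topological_space set \<Rightarrow> (real \<Rightarrow> 'a) set \<Rightarrow> (real \<Rightarrow> 'a) set" where
  "inclusion_hom S A = (\<Union>p\<in>A. loop_class S p)"

section \<open>Perturbations\<close>

text \<open>\<open>T\<close> is a closed neighbourhood of \<open>B\<close> with bicollared frontier, and \<open>T\<close> is the mapping cylinder
  of a map from the frontier of \<open>T\<close> onto \<open>B\<close>: the point \<open>h (y, t)\<close> moves from \<open>y\<close> at \<open>t = 0\<close>
  to a point of \<open>B\<close> at \<open>t = 1\<close>, and out of \<open>T\<close> for negative \<open>t\<close>.\<close>

definition regular_neighborhood :: "'a::topological_space set \<Rightarrow> 'a set \<Rightarrow> bool" where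
  "regular_neighborhood B T \<longleftrightarrow> compact T \<and> B \<subseteq> interior T \<and>
     (\<exists>(h :: 'a \<times> real \<Rightarrow> 'a) k.
        continuous_on (frontier T \<times> {-1..1}) h \<and>
        (\<forall>y\<in>frontier T. h (y, 0) = y) \<and>
        homeomorphism (frontier T \<times> {-1..<1}) (h ` (frontier T \<times> {-1..<1})) h k \<and>
        open (h ` (frontier T \<times> {-1<..<1})) \<and>
        h ` (frontier T \<times> {-1..<0}) \<subseteq> - T \<and>
        h ` (frontier T \<times> {0..<1}) = T - B \<and>
        h ` (frontier T \<times> {1}) = B)"

text \<open>The smallness of a perturbation is measured by a regular neighbourhood \<open>T\<close> of the original
  curve: the perturbed curve is joined to it by a continuous family of sextics that stay in \<open>T\<close>.
  Every sextic with coefficients sufficiently close to those of \<open>F\<close> has this property.  For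
  forms of a given degree, pointwise continuity of the family is continuity of the coefficients.\<close>

definition small_perturbation ::
    "(complex^3 \<Rightarrow> complex) \<Rightarrow> cp2 set \<Rightarrow> (complex^3 \<Rightarrow> complex) \<Rightarrow> bool" where
  "small_perturbation F T F' \<longleftrightarrow> regular_neighborhood (curve F) T \<and>
     (\<exists>E :: real \<Rightarrow> complex^3 \<Rightarrow> complex. E 0 = F \<and> E 1 = F' \<and>
        (\<forall>t\<in>{0..1}. plane_sextic (E t) \<and> curve (E t) \<subseteq> T) \<and>
        (\<forall>v. continuous_on {0..1} (\<lambda>t. E t v)))"

definition curve_group :: "(complex^3 \<Rightarrow> complex) \<Rightarrow> cp2 \<Rightarrow> (real \<Rightarrow> cp2) set monoid" where
  "curve_group F x = fundamental_group (- curve F) x"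

text \<open>Apply the inverse of the isomorphism induced by the inclusion of the complement of \<open>T\<close> in
  the complement of \<open>F = 0\<close>, then the map induced by its inclusion in that of \<open>F' = 0\<close>.\<close>

definition perturbation_epi ::
    "(complex^3 \<Rightarrow> complex) \<Rightarrow> cp2 set \<Rightarrow> (complex^3 \<Rightarrow> complex) \<Rightarrow> cp2 \<Rightarrow>
     (real \<Rightarrow> cp2) set \<Rightarrow> (real \<Rightarrow> cp2) set" where
  "perturbation_epi F T F' x =
     inclusion_hom (- curve F') \<circ>
     inv_into (carrier (fundamental_group (- T) x)) (inclusion_hom (- curve F))"

end

theory Submission
  imports Defs "HOL-Algebra.Sym_Groups"
begin

text \<open>A curve group that admitted an isomorphic perturbation would make the source and target groups
  \<open>G\<close> and \<open>H\<close> abstractly isomorphic, and this is impossible. A map of generators gives an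
  epimorphism \<open>\<pi> : G \<rightarrow> H\<close>. For a finite group \<open>K\<close> the set \<open>Hom(G, K)\<close> is finite, as
  \<open>G\<close> is finitely generated, and composition with \<open>\<pi>\<close> embeds \<open>Hom(H, K)\<close> in it. If \<open>G \<cong> H\<close>,
  both sets have the same size, so every homomorphism \<open>G \<rightarrow> K\<close> factors through \<open>\<pi>\<close>. But some
  homomorphism of \<open>G\<close> to the symmetric group of degree 4 or 8 separates two elements that \<open>\<pi>\<close>
  identifies.\<close>

section \<open>Presented groups\<close>

abbreviation words :: "'a set \<Rightarrow> 'a word set" where
  "words X \<equiv> lists (X \<times> UNIV)"

section \<open>Evaluation of words in a group\<close>

definition word_eval :: "('g, 'm) monoid_scheme \<Rightarrow> ('a \<Rightarrow> 'g) \<Rightarrow> 'a word \<Rightarrow> 'g" where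
  "word_eval G f w = foldr (\<lambda>(a, s) y. (if s then f a else inv\<^bsub>G\<^esub> f a) \<otimes>\<^bsub>G\<^esub> y) w \<one>\<^bsub>G\<^esub>"

lemma word_eval_Nil [simp]: "word_eval G f [] = \<one>\<^bsub>G\<^esub>"
  by (simp add: word_eval_def)

lemma word_eval_Cons [simp]:
  "word_eval G f ((a, s) # w) = (if s then f a else inv\<^bsub>G\<^esub> f a) \<otimes>\<^bsub>G\<^esub> word_eval G f w"
  by (simp add: word_eval_def)

lemma gen_in_words [simp]: "gen a \<in> words X \<longleftrightarrow> a \<in> X"
  by (auto simp: gen_def)

lemma winv_in_words [simp]: "winv w \<in> words X \<longleftrightarrow> w \<in> words X"
  by (force simp: winv_def in_lists_conv_set)

lemma wpow_in_words: "w \<in> words X \<Longrightarrow> wpow w n \<in> words X"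
  by (induction n) (auto simp: wpow_def)

lemma (in group) word_eval_closed [simp]:
  assumes "f \<in> X \<rightarrow> carrier G" "w \<in> words X"
  shows "word_eval G f w \<in> carrier G"
  using assms(2)
proof (induction w)
  case (Cons p w)
  then show ?case using assms(1) by (cases p) auto
qed simp

lemma (in group) word_eval_append:
  assumes "f \<in> X \<rightarrow> carrier G" "u \<in> words X" "v \<in> words X"
  shows "word_eval G f (u @ v) = word_eval G f u \<otimes> word_eval G f v"
  using assms(2)
proof (induction u)
  case Nil
  then show ?case using word_eval_closed[OF assms(1,3)] by simp
next
  case (Cons p u)
  obtain a s where p: "p = (a, s)" by fastforce
  have "u \<in> words X" "f a \<in> carrier G" using Cons(1,2) p assms(1) by auto
  then show ?case
    using Cons(3) word_eval_closed[OF assms(1), of u] word_eval_closed[OF assms(1,3)] p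
    by (simp add: m_assoc)
qed

lemma hom_word_eval:
  assumes "group G" "group H" "h \<in> hom G H" "f \<in> X \<rightarrow> carrier G" "w \<in> words X"
  shows "h (word_eval G f w) = word_eval H (h \<circ> f) w"
proof -
  interpret group_hom G H h
    using assms(1-3) by (simp add: group_hom_def group_hom_axioms_def)
  show ?thesis using assms(5)
  proof (induction w)
    case (Cons p w)
    obtain a s where p: "p = (a, s)" by fastforce
    have "w \<in> words X" "f a \<in> carrier G" using Cons(1,2) p assms(4) by auto
    then show ?case
      using Cons(3) G.word_eval_closed[OF assms(4), of w] p by simp
  qed simp
qed

section \<open>The group of a presentation and its universal property\<close>

lemma pres_eq_winv: "w \<in> words X \<Longrightarrow> pres_eq X R (winv w @ w) []"
proof (induction w)
  case Nil
  then show ?case by (simp add: winv_def pres_eq.refl)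
next
  case (Cons p w)
  obtain a s where p: "p = (a, s)" by fastforce
  have w: "w \<in> words X" and a: "a \<in> X" using Cons.prems p by auto
  \<comment> \<open>\<open>winv\<close> reverses the word, so the two letters that meet in the
    middle are mutually inverse; the double negation makes the pair an instance of
    \<open>cancel\<close>.\<close>
  have "pres_eq X R ([(a, \<not> s), (a, \<not> \<not> s)] @ w) ([] @ w)"
    by (intro pres_eq.append pres_eq.cancel pres_eq.refl a w)
  then have "pres_eq X R (winv w @ ([(a, \<not> s), (a, s)] @ w)) (winv w @ w)"
    by (intro pres_eq.append pres_eq.refl) (use w in simp_all)
  moreover have "winv (p # w) @ p # w = winv w @ ([(a, \<not> s), (a, s)] @ w)"
    by (simp add: winv_def p)
  ultimately show ?case using Cons.IH[OF w] pres_eq.trans by metis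
qed

text \<open>The assumption keeps \<open>pres_eq\<close> inside the words over \<open>X\<close>: the
  rule \<open>relation\<close> could otherwise bring in foreign letters, while reflexivity holds
  only on \<open>words X\<close>.\<close>

locale presentation =
  fixes X :: "'a set" and R :: "('a word \<times> 'a word) set"
  assumes relations_in_words: "R \<subseteq> words X \<times> words X"
begin

abbreviation P :: "'a word set monoid" where "P \<equiv> presented_group X R"

abbreviation cls :: "'a word \<Rightarrow> 'a word set" where "cls \<equiv> word_class X R"

lemma pres_eq_in_words: "pres_eq X R u v \<Longrightarrow> u \<in> words X \<and> v \<in> words X"
  by (induction rule: pres_eq.induct) (use relations_in_words in auto)

lemma cls_eq_iff: "v \<in> words X \<Longrightarrow> cls u = cls v \<longleftrightarrow> pres_eq X R u v"
  unfolding word_class_def by (blast intro: pres_eq.refl pres_eq.sym pres_eq.trans)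

lemma cls_relation: "(u, v) \<in> R \<Longrightarrow> cls u = cls v"
  using cls_eq_iff relations_in_words pres_eq.relation by blast

lemma carrier_P: "carrier P = cls ` words X"
  by (simp add: presented_group_def)

lemma one_P: "\<one>\<^bsub>P\<^esub> = cls []"
  by (simp add: presented_group_def)

lemma cls_closed [simp]: "w \<in> words X \<Longrightarrow> cls w \<in> carrier P"
  by (simp add: carrier_P)

text \<open>The product of two classes is a union over all representatives. By congruence every set
  in this union is the same class, so one pair of representatives determines it.\<close>

lemma cls_append:
  assumes "u \<in> words X" "v \<in> words X"
  shows "cls u \<otimes>\<^bsub>P\<^esub> cls v = cls (u @ v)"
proof -
  have "cls (u' @ v') = cls (u @ v)" if "u' \<in> cls u" "v' \<in> cls v" for u' v'
  proof -
    have "pres_eq X R (u @ v) (u' @ v')"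
      using that by (auto simp: word_class_def intro: pres_eq.append)
    then show ?thesis using cls_eq_iff pres_eq_in_words by metis
  qed
  moreover have "u \<in> cls u" "v \<in> cls v"
    using assms by (auto simp: word_class_def intro: pres_eq.refl)
  ultimately have "(\<Union>u'\<in>cls u. \<Union>v'\<in>cls v. cls (u' @ v')) = cls (u @ v)"
    by blast
  then show ?thesis by (simp add: presented_group_def)
qed

lemma group_P: "group P"
proof (rule groupI)
  show "\<one>\<^bsub>P\<^esub> \<in> carrier P" by (simp add: one_P)
next
  fix x y assume "x \<in> carrier P" "y \<in> carrier P"
  then obtain u v where "x = cls u" "y = cls v" "u \<in> words X" "v \<in> words X"
    by (auto simp: carrier_P)
  then show "x \<otimes>\<^bsub>P\<^esub> y \<in> carrier P" by (simp add: cls_append)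
next
  fix x y z assume "x \<in> carrier P" "y \<in> carrier P" "z \<in> carrier P"
  then obtain u v w where "x = cls u" "y = cls v" "z = cls w"
      "u \<in> words X" "v \<in> words X" "w \<in> words X"
    by (auto simp: carrier_P)
  then show "x \<otimes>\<^bsub>P\<^esub> y \<otimes>\<^bsub>P\<^esub> z = x \<otimes>\<^bsub>P\<^esub> (y \<otimes>\<^bsub>P\<^esub> z)"
    by (simp add: cls_append)
next
  fix x assume "x \<in> carrier P"
  then obtain u where u: "x = cls u" "u \<in> words X"
    by (auto simp: carrier_P)
  then show "\<one>\<^bsub>P\<^esub> \<otimes>\<^bsub>P\<^esub> x = x" by (simp add: one_P cls_append)
  show "\<exists>y\<in>carrier P. y \<otimes>\<^bsub>P\<^esub> x = \<one>\<^bsub>P\<^esub>"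
  proof
    show "cls (winv u) \<otimes>\<^bsub>P\<^esub> x = \<one>\<^bsub>P\<^esub>"
      using u by (simp add: cls_append one_P cls_eq_iff pres_eq_winv)
  qed (use u in simp)
qed

sublocale P: group P
  by (rule group_P)

lemma inv_cls: "w \<in> words X \<Longrightarrow> inv\<^bsub>P\<^esub> cls w = cls (winv w)"
  by (rule P.inv_equality) (simp_all add: cls_append one_P cls_eq_iff pres_eq_winv)

lemma cls_gen_funcset: "(\<lambda>a. cls (gen a)) \<in> X \<rightarrow> carrier P"
  by simp

text \<open>The class map is itself an evaluation, so by \<open>hom_word_eval\<close> a homomorphism
  out of \<open>P\<close> is determined by its values on the generators.\<close>

lemma word_eval_cls: "w \<in> words X \<Longrightarrow> word_eval P (\<lambda>a. cls (gen a)) w = cls w"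
proof (induction w)
  case Nil
  then show ?case by (simp add: one_P)
next
  case (Cons p w)
  obtain a s where p: "p = (a, s)" by fastforce
  have "(if s then cls (gen a) else inv\<^bsub>P\<^esub> cls (gen a)) = cls [(a, s)]"
    using inv_cls[of "gen a"] Cons.prems p by (cases s) (simp_all add: gen_def winv_def)
  then show ?case using Cons p by (simp add: cls_append)
qed

text \<open>Evaluation respects every rule generating the congruence, the relations by hypothesis.
  It is therefore constant on classes and may be computed on any chosen representative.\<close>

lemma von_Dyck:
  assumes "group G" "f \<in> X \<rightarrow> carrier G"
    and rel: "\<And>u v. (u, v) \<in> R \<Longrightarrow> word_eval G f u = word_eval G f v"
  obtains h where "h \<in> hom P G" "\<And>w. w \<in> words X \<Longrightarrow> h (cls w) = word_eval G f w"
proof -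
  interpret G: group G by fact
  have sound: "word_eval G f u = word_eval G f v" if "pres_eq X R u v" for u v
    using that
  proof induction
    case (append u u' v v')
    then show ?case
      using pres_eq_in_words[of u u'] pres_eq_in_words[of v v'] G.word_eval_append[OF assms(2)]
      by metis
  next
    case (cancel a s)
    then show ?case using assms(2) by (cases s) (auto simp: Pi_iff)
  qed (use rel in auto)
  define h where "h A = word_eval G f (SOME w. w \<in> A)" for A
  have h: "h (cls w) = word_eval G f w" if "w \<in> words X" for w
  proof -
    have "w \<in> cls w" using that by (simp add: word_class_def pres_eq.refl)
    then have "(SOME v. v \<in> cls w) \<in> cls w" by (rule someI)
    then show ?thesis unfolding h_def by (simp add: word_class_def sound)
  qed
  have "h \<in> hom P G"
  proof (rule homI)
    fix x y assume "x \<in> carrier P" "y \<in> carrier P"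
    then obtain u v where "x = cls u" "y = cls v" "u \<in> words X" "v \<in> words X"
      by (auto simp: carrier_P)
    then show "h (x \<otimes>\<^bsub>P\<^esub> y) = h x \<otimes>\<^bsub>G\<^esub> h y"
      using G.word_eval_append[OF assms(2)] h[of u] h[of v] h[of "u @ v"] by (simp add: cls_append)
  next
    fix x assume "x \<in> carrier P"
    then obtain u where "x = cls u" "u \<in> words X"
      by (auto simp: carrier_P)
    then show "h x \<in> carrier G" using h G.word_eval_closed[OF assms(2)] by simp
  qed
  then show thesis using h that by blast
qed

text \<open>Values on the finitely many generators determine a homomorphism, so restriction to them
  injects into a finite function space. Taking \<open>extensional\<close> functions fixes the
  otherwise arbitrary values off the carrier.\<close>

lemma finite_hom:
  assumes "finite X" "group K" "finite (carrier K)"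
  shows "finite (hom P K \<inter> extensional (carrier P))"
proof (rule inj_on_finite)
  show "finite (X \<rightarrow>\<^sub>E carrier K)" using assms by (simp add: finite_PiE)
  show "(\<lambda>h. \<lambda>a\<in>X. h (cls (gen a))) ` (hom P K \<inter> extensional (carrier P)) \<subseteq> X \<rightarrow>\<^sub>E carrier K"
    by (auto simp: hom_def Pi_iff)
  show "inj_on (\<lambda>h. \<lambda>a\<in>X. h (cls (gen a))) (hom P K \<inter> extensional (carrier P))"
  proof (rule inj_onI)
    fix g h
    assume g: "g \<in> hom P K \<inter> extensional (carrier P)" and h: "h \<in> hom P K \<inter> extensional (carrier P)"
      and eq: "(\<lambda>a\<in>X. g (cls (gen a))) = (\<lambda>a\<in>X. h (cls (gen a)))"
    have gen: "g (cls (gen a)) = h (cls (gen a))" if "a \<in> X" for a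
      using fun_cong[OF eq, of a] that by simp
    have "g (cls w) = h (cls w)" if w: "w \<in> words X" for w
    proof -
      have "word_eval K (g \<circ> (\<lambda>a. cls (gen a))) w = word_eval K (h \<circ> (\<lambda>a. cls (gen a))) w"
        using w by (induction w) (auto simp: gen)
      then show ?thesis
        using hom_word_eval[OF group_P assms(2) _ cls_gen_funcset w] g h word_eval_cls[OF w] by auto
    qed
    then show "g = h"
      using g h by (intro extensionalityI[of g "carrier P"]) (auto simp: carrier_P)
  qed
qed

text \<open>Adding the relator \<open>w\<close> gives a surjection of \<open>P\<close> onto the new
  group. Its kernel is the normal closure of \<open>cls w\<close>, and the first isomorphism theorem
  applies.\<close>

lemma Mod_normal_closure_iso:
  assumes w: "w \<in> words X"
  shows "P Mod normal_closure P {cls w} \<cong> presented_group X (insert (w, []) R)"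
proof -
  interpret Q: presentation X "insert (w, []) R"
    using w relations_in_words by unfold_locales auto
  obtain h where h: "h \<in> hom P Q.P" and "\<And>v. v \<in> words X \<Longrightarrow> h (cls v) = word_eval Q.P (\<lambda>a. Q.cls (gen a)) v"
  proof (rule von_Dyck[OF Q.group_P Q.cls_gen_funcset])
    fix u v assume uv: "(u, v) \<in> R"
    then have "u \<in> words X" "v \<in> words X" using relations_in_words by auto
    then show "word_eval Q.P (\<lambda>a. Q.cls (gen a)) u = word_eval Q.P (\<lambda>a. Q.cls (gen a)) v"
      using uv Q.cls_relation[of u v] Q.word_eval_cls by simp
  qed blast
  then have h_cls: "h (cls v) = Q.cls v" if "v \<in> words X" for v
    using that Q.word_eval_cls by simp
  interpret h: group_hom P Q.P h
    using h by (simp add: group_hom_def group_hom_axioms_def group_P Q.group_P)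
  have "h ` cls ` words X = Q.cls ` words X"
    unfolding image_image by (rule image_cong[OF HOL.refl h_cls])
  then have surj: "h ` carrier P = carrier Q.P"
    by (simp add: carrier_P Q.carrier_P)
  have "cls w \<in> kernel P Q.P h"
    using w h_cls Q.cls_relation[of w "[]"] by (simp add: kernel_def Q.one_P)
  then have "normal_closure P {cls w} \<subseteq> kernel P Q.P h"
    using h.normal_kernel unfolding normal_closure_def by blast
  \<comment> \<open>The normal closure is an intersection, so the kernel is bounded by each normal
    \<open>N\<close> containing \<open>cls w\<close> in turn. The coset map modulo \<open>N\<close>
    satisfies the relations of the new group and factors through it; a word trivial there has
    trivial coset, that is, its class lies in \<open>N\<close>.\<close>
  moreover have "kernel P Q.P h \<subseteq> N" if N: "N \<lhd> P" "cls w \<in> N" for N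
  proof
    fix x assume x: "x \<in> kernel P Q.P h"
    then obtain v where v: "v \<in> words X" "x = cls v"
      unfolding kernel_def carrier_P by blast
    then have v1: "Q.cls v = Q.cls []"
      using x h_cls by (simp add: kernel_def Q.one_P)
    interpret N: normal N P by fact
    define g where "g = (\<lambda>a. N #>\<^bsub>P\<^esub> cls (gen a))"
    have q: "(\<lambda>x. N #>\<^bsub>P\<^esub> x) \<in> hom P (P Mod N)" by (rule N.r_coset_hom_Mod)
    have g: "g \<in> X \<rightarrow> carrier (P Mod N)"
      using hom_in_carrier[OF q] by (auto simp: g_def)
    have eval: "word_eval (P Mod N) g u = N #>\<^bsub>P\<^esub> cls u" if "u \<in> words X" for u
      using hom_word_eval[OF group_P N.factorgroup_is_group q cls_gen_funcset that] that
      by (simp add: word_eval_cls comp_def g_def)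
    have "word_eval (P Mod N) g u = word_eval (P Mod N) g u'" if "(u, u') \<in> insert (w, []) R" for u u'
    proof (cases "(u, u') \<in> R")
      case True
      moreover from True have "u \<in> words X" "u' \<in> words X" using relations_in_words by auto
      ultimately show ?thesis using cls_relation[of u u'] by (simp add: eval)
    next
      case False
      then have "u = w" "u' = []" using that by auto
      moreover have "N #>\<^bsub>P\<^esub> cls w = N"
        by (rule P.coset_join2[OF cls_closed[OF w] N.subgroup_axioms N(2)])
      moreover have "\<one>\<^bsub>P Mod N\<^esub> = N" by (simp add: FactGroup_def)
      ultimately show ?thesis using eval[OF w] by simp
    qed
    then obtain k where k: "\<And>u. u \<in> words X \<Longrightarrow> k (Q.cls u) = word_eval (P Mod N) g u"
      using Q.von_Dyck[OF N.factorgroup_is_group g] by metis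
    have "N #>\<^bsub>P\<^esub> cls v = \<one>\<^bsub>P Mod N\<^esub>"
      using k[OF v(1)] k[of "[]"] v v1 eval by simp
    then show "x \<in> N"
      using v P.rcos_self[OF cls_closed N.subgroup_axioms] by (auto simp: FactGroup_def)
  qed
  then have "kernel P Q.P h \<subseteq> normal_closure P {cls w}"
    unfolding normal_closure_def by auto
  ultimately show ?thesis
    using h.FactGroup_iso[OF surj] by simp
qed

end

section \<open>Distinguishing presented groups\<close>

text \<open>Composing \<pi> with an isomorphism from \<open>H\<close> back to \<open>G\<close> gives
  a surjective endomorphism \<psi> of \<open>G\<close>. Precomposition with \<psi> is then an
  injective self-map of the finite set of homomorphisms to \<open>K\<close>, hence onto; so
  \<open>f\<close> agrees on the carrier with some \<open>g \<circ> \<psi>\<close> and cannot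
  separate what \<pi> identifies.\<close>

lemma hom_factors_through_epi:
  assumes "group G" "G \<cong> H" "\<pi> \<in> epi G H"
    and fin: "finite (hom G K \<inter> extensional (carrier G))"
    and f: "f \<in> hom G K" and ab: "a \<in> carrier G" "b \<in> carrier G" "\<pi> a = \<pi> b"
  shows "f a = f b"
proof -
  interpret group G by fact
  obtain \<phi> where \<phi>: "\<phi> \<in> iso H G"
    using iso_sym[OF assms(2)] by (auto simp: is_iso_def)
  define \<psi> where "\<psi> = \<phi> \<circ> \<pi>"
  have "\<phi> \<in> hom H G" "\<phi> ` carrier H = carrier G"
    using \<phi> by (auto simp: iso_iff)
  moreover have "\<pi> \<in> hom G H" "\<pi> ` carrier G = carrier H"
    using assms(3) by (simp_all add: epi_def)
  ultimately have \<psi>: "\<psi> \<in> hom G G \<and> \<psi> ` carrier G = carrier G"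
    unfolding \<psi>_def using Group.hom_compose by (metis image_comp)
  let ?A = "hom G K \<inter> extensional (carrier G)"
  let ?\<Phi> = "\<lambda>g. restrict (g \<circ> \<psi>) (carrier G)"
  have "?\<Phi> ` ?A \<subseteq> ?A"
    using \<psi> by (auto simp: hom_def Pi_iff)
  moreover have "inj_on ?\<Phi> ?A"
  proof (rule inj_onI)
    fix g h assume g: "g \<in> ?A" and h: "h \<in> ?A" and eq: "?\<Phi> g = ?\<Phi> h"
    have "g (\<psi> x) = h (\<psi> x)" if "x \<in> carrier G" for x
      using fun_cong[OF eq, of x] that by simp
    then have "g y = h y" if "y \<in> carrier G" for y
      using that \<psi> by (metis imageE)
    then show "g = h"
      using g h by (intro extensionalityI[of g "carrier G"]) auto
  qed
  ultimately have "?\<Phi> ` ?A = ?A"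
    using fin endo_inj_surj by blast
  \<comment> \<open>\<open>f\<close> itself may be arbitrary off the carrier; its restriction is the
    element of \<open>?A\<close> to be hit.\<close>
  moreover have "restrict f (carrier G) \<in> ?A"
    using f by (auto simp: hom_def Pi_iff)
  ultimately obtain g where "restrict f (carrier G) = ?\<Phi> g" by blast
  then have "f x = g (\<psi> x)" if "x \<in> carrier G" for x
    using that by (metis comp_apply restrict_apply')
  then show ?thesis using ab by (simp add: \<psi>_def)
qed

text \<open>Reduces non-isomorphism to checks on words. By von Dyck, \<open>rel\<close> turns the
  renaming \<open>m\<close> into an epimorphism and \<open>relK\<close> turns \<open>f\<close> into
  a homomorphism to \<open>K\<close>; \<open>m\<close> identifies the words \<open>p\<close> and
  \<open>q\<close>, and \<open>f\<close> separates them.\<close>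

lemma presented_groups_not_iso:
  assumes "presentation X R" "presentation Y S" and m: "m ` X = Y" and "finite X"
    and rel: "\<forall>(u, v)\<in>R.
      word_eval (presented_group Y S) (\<lambda>a. word_class Y S (gen (m a))) u =
      word_eval (presented_group Y S) (\<lambda>a. word_class Y S (gen (m a))) v"
    and K: "group K" "finite (carrier K)" and f: "f \<in> X \<rightarrow> carrier K"
    and relK: "\<forall>(u, v)\<in>R. word_eval K f u = word_eval K f v"
    and pq: "p \<in> words X" "q \<in> words X"
      "word_eval (presented_group Y S) (\<lambda>a. word_class Y S (gen (m a))) p =
       word_eval (presented_group Y S) (\<lambda>a. word_class Y S (gen (m a))) q"
      "word_eval K f p \<noteq> word_eval K f q"
  shows "\<not> presented_group X R \<cong> presented_group Y S"
proof
  assume iso: "presented_group X R \<cong> presented_group Y S"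
  interpret G: presentation X R by fact
  interpret H: presentation Y S by fact
  let ?g = "\<lambda>a. H.cls (gen (m a))"
  have "m a \<in> Y" if "a \<in> X" for a using m that by blast
  then have g: "?g \<in> X \<rightarrow> carrier H.P" by simp
  have rel': "word_eval H.P ?g u = word_eval H.P ?g v" "word_eval K f u = word_eval K f v"
    if "(u, v) \<in> R" for u v
    using rel relK that by auto
  obtain \<pi> where \<pi>: "\<pi> \<in> hom G.P H.P" "\<And>w. w \<in> words X \<Longrightarrow> \<pi> (G.cls w) = word_eval H.P ?g w"
    using G.von_Dyck[OF H.group_P g rel'(1)] by blast
  \<comment> \<open>Since \<open>m\<close> maps onto \<open>Y\<close>, a word over \<open>Y\<close>
    lifts letter by letter, with signs kept, to a word over \<open>X\<close>.\<close>
  have "H.cls v \<in> \<pi> ` carrier G.P" if v: "v \<in> words Y" for v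
  proof -
    have "\<exists>w\<in>words X. word_eval H.P ?g w = word_eval H.P (\<lambda>b. H.cls (gen b)) v"
      using v
    proof (induction v)
      case Nil
      show ?case by (intro bexI[of _ "[]"]) auto
    next
      case (Cons p v)
      obtain b s where p: "p = (b, s)" by fastforce
      obtain a where a: "a \<in> X" "b = m a" using Cons p m by auto
      obtain w where "w \<in> words X" "word_eval H.P ?g w = word_eval H.P (\<lambda>b. H.cls (gen b)) v"
        using Cons by auto
      then show ?case using a p by (intro bexI[of _ "(a, s) # w"]) auto
    qed
    then show ?thesis
      using \<pi>(2) H.word_eval_cls[OF v] by (metis G.cls_closed image_eqI)
  qed
  then have "\<pi> \<in> epi G.P H.P"
    unfolding epi_iff_subset H.carrier_P using \<pi>(1) by blast
  moreover obtain h where "h \<in> hom G.P K" "\<And>w. w \<in> words X \<Longrightarrow> h (G.cls w) = word_eval K f w"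
    using G.von_Dyck[OF K(1) f rel'(2)] by blast
  ultimately have "word_eval K f p = word_eval K f q"
    using hom_factors_through_epi[OF G.group_P iso _ G.finite_hom[OF assms(4) K], of \<pi> h "G.cls p" "G.cls q"]
      \<pi>(2) pq by simp
  then show False using pq by simp
qed

text \<open>Keeps the numeral \<open>1\<close> from turning into \<open>Suc 0\<close>, so that
  generators and list entries stay literals.\<close>

declare One_nat_def [simp del]

section \<open>Permutations in list notation\<close>

text \<open>One-line notation: the image of the point i sits at list index i - 1. Points outside the
  range are fixed, as \<open>permutes\<close> in \<open>sym_group\<close> requires.\<close>

definition perm_of :: "nat list \<Rightarrow> nat \<Rightarrow> nat" where
  "perm_of xs i = (if i \<in> {1..length xs} then xs ! (i - 1) else i)"

text \<open>Turns composition into a list computation. The right factor acts first, so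
  \<open>xs\<close> is looked up at the entries of \<open>ys\<close>, which the range condition
  makes valid positions.\<close>

lemma perm_of_comp:
  assumes "length xs = length ys" "set ys \<subseteq> {1..length ys}"
  shows "perm_of xs \<circ> perm_of ys = perm_of (map (\<lambda>i. xs ! (i - 1)) ys)"
proof
  fix i
  show "(perm_of xs \<circ> perm_of ys) i = perm_of (map (\<lambda>i. xs ! (i - 1)) ys) i"
  proof (cases "i \<in> {1..length ys}")
    case True
    then have i: "i - 1 < length ys" by auto
    then have "ys ! (i - 1) \<in> {1..length ys}" using assms(2) nth_mem by blast
    then show ?thesis using True i assms(1) by (simp add: perm_of_def)
  next
    case False
    then show ?thesis using assms(1) by (auto simp: perm_of_def)
  qed
qed

lemma perm_of_eq_iff: "length xs = length ys \<Longrightarrow> perm_of xs = perm_of ys \<longleftrightarrow> xs = ys"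
proof
  assume len: "length xs = length ys" and eq: "perm_of xs = perm_of ys"
  show "xs = ys"
  proof (rule nth_equalityI)
    fix i assume "i < length xs"
    \<comment> \<open>List index \<open>i\<close> holds the value at the point i + 1.\<close>
    then show "xs ! i = ys ! i"
      using fun_cong[OF eq, of "Suc i"] len by (simp add: perm_of_def)
  qed (rule len)
qed simp

lemma perm_of_upt: "perm_of [1..<Suc n] = id"
  by (auto simp: perm_of_def fun_eq_iff simp del: upt_Suc)

text \<open>The list \<open>ys\<close> is a certificate: both composites being the identity gives
  bijectivity of \<open>perm_of xs\<close> and names its inverse.\<close>

lemma perm_of_inv:
  assumes "length xs = n" "set xs \<subseteq> {1..n}" "map (\<lambda>i. ys ! (i - 1)) xs = [1..<Suc n]"
    and "length ys = n" "set ys \<subseteq> {1..n}" "map (\<lambda>i. xs ! (i - 1)) ys = [1..<Suc n]"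
  shows "perm_of xs \<in> carrier (sym_group n)" "inv\<^bsub>sym_group n\<^esub> perm_of xs = perm_of ys"
proof -
  have id: "perm_of xs \<circ> perm_of ys = id" "perm_of ys \<circ> perm_of xs = id"
    using assms perm_of_comp[of xs ys] perm_of_comp[of ys xs] perm_of_upt[of n] by metis+
  then have "bij (perm_of xs)" by (metis o_bij)
  then show closed: "perm_of xs \<in> carrier (sym_group n)"
    using assms(1) by (auto simp: sym_group_carrier perm_of_def permutes_def bij_iff)
  have "inv' (perm_of xs) = perm_of ys"
    using id by (intro inv_unique_comp)
  then show "inv\<^bsub>sym_group n\<^esub> perm_of xs = perm_of ys"
    using closed by simp
qed

lemma upt_4: "[1..<Suc 4] = [1, 2, 3, 4]"
  by (simp add: upt_rec)

lemma upt_8: "[1..<Suc 8] = [1, 2, 3, 4, 5, 6, 7, 8]"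
  by (simp add: upt_rec)

lemmas perm_of_id = perm_of_upt[of 4, unfolded upt_4] perm_of_upt[of 8, unfolded upt_8]

lemma finite_sym_group: "finite (carrier (sym_group n))"
  by (simp add: sym_group_def finite_permutations)

section \<open>Relations in the braid quotients\<close>

lemma (in group) inv_cancel_left:
  assumes "x \<in> carrier G" "y \<in> carrier G"
  shows "inv x \<otimes> (x \<otimes> y) = y" "x \<otimes> (inv x \<otimes> y) = y"
  using assms by (simp_all flip: m_assoc)

text \<open>The six-letter words are all spellings of the full twist (a b)^3. Apart from the final
  braid identity, the others say that conjugation by a b takes a to b, which evaluates the words
  \<open>\<alpha>b\<close> and \<open>\<beta>b\<close>. Products are nested to the right, as
  \<open>word_eval\<close> yields them; a tail \<open>x\<close> lets a rule apply inside a longer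
  product.\<close>

lemma (in group) B3_quotient_identities:
  assumes [simp]: "a \<in> carrier G" "b \<in> carrier G"
    and braid: "a \<otimes> (b \<otimes> a) = b \<otimes> (a \<otimes> b)"
    and centre: "a \<otimes> (b \<otimes> (a \<otimes> (b \<otimes> (a \<otimes> b)))) = \<one>"
  shows "b \<otimes> (a \<otimes> (b \<otimes> (a \<otimes> (b \<otimes> a)))) = \<one>"
    and "b \<otimes> (a \<otimes> (b \<otimes> (b \<otimes> (a \<otimes> b)))) = \<one>"
    and "a \<otimes> (a \<otimes> (b \<otimes> (a \<otimes> (a \<otimes> b)))) = \<one>"
    and "b \<otimes> (a \<otimes> (a \<otimes> (b \<otimes> (a \<otimes> a)))) = \<one>"
    and "a \<otimes> (b \<otimes> (b \<otimes> (a \<otimes> (b \<otimes> b)))) = \<one>"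
    and "a \<otimes> (b \<otimes> (a \<otimes> (inv b \<otimes> inv a))) = b"
    and "x \<in> carrier G \<Longrightarrow> a \<otimes> (b \<otimes> (a \<otimes> (inv b \<otimes> (inv a \<otimes> x)))) = b \<otimes> x"
    and "inv b \<otimes> (inv a \<otimes> (b \<otimes> (a \<otimes> b))) = a"
    and "x \<in> carrier G \<Longrightarrow> inv b \<otimes> (inv a \<otimes> (b \<otimes> (a \<otimes> (b \<otimes> x)))) = a \<otimes> x"
    and "x \<in> carrier G \<Longrightarrow> inv b \<otimes> (inv a \<otimes> (inv b \<otimes> (a \<otimes> (b \<otimes> x)))) = inv a \<otimes> x"
    and "inv a \<otimes> (b \<otimes> a) = b \<otimes> (a \<otimes> inv b)"
proof -
  have braid': "b \<otimes> (a \<otimes> (b \<otimes> x)) = a \<otimes> (b \<otimes> (a \<otimes> x))" if [simp]: "x \<in> carrier G" for x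
    using arg_cong[OF braid, of "\<lambda>y. y \<otimes> x"] by (simp add: m_assoc)
  show "b \<otimes> (a \<otimes> (b \<otimes> (a \<otimes> (b \<otimes> a)))) = \<one>"
    \<comment> \<open>From x y = 1 follows y x = 1, so the first letter may be moved to the
      end.\<close>
    using inv_comm[of a "b \<otimes> (a \<otimes> (b \<otimes> (a \<otimes> b)))"] centre by (simp add: m_assoc)
  show "b \<otimes> (a \<otimes> (b \<otimes> (b \<otimes> (a \<otimes> b)))) = \<one>"
    using centre by (simp add: braid')
  show "inv a \<otimes> (b \<otimes> a) = b \<otimes> (a \<otimes> inv b)"
  proof -
    have "b \<otimes> a = a \<otimes> (b \<otimes> (a \<otimes> inv b))"
      using braid'[of "inv b"] by simp
    then show ?thesis by (simp add: inv_cancel_left)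
  qed
  show "a \<otimes> (a \<otimes> (b \<otimes> (a \<otimes> (a \<otimes> b)))) = \<one>"
    using centre braid'[of "a \<otimes> b"] by simp
  then show "b \<otimes> (a \<otimes> (a \<otimes> (b \<otimes> (a \<otimes> a)))) = \<one>"
    using inv_comm[of "a \<otimes> (a \<otimes> (b \<otimes> (a \<otimes> a)))" b] by (simp add: m_assoc)
  show "a \<otimes> (b \<otimes> (b \<otimes> (a \<otimes> (b \<otimes> b)))) = \<one>"
    using centre braid'[of b] by simp
  show 1: "a \<otimes> (b \<otimes> (a \<otimes> (inv b \<otimes> (inv a \<otimes> x)))) = b \<otimes> x" if [simp]: "x \<in> carrier G" for x
    using braid'[of "inv b \<otimes> (inv a \<otimes> x)"] by (simp add: inv_cancel_left)
  show "a \<otimes> (b \<otimes> (a \<otimes> (inv b \<otimes> inv a))) = b"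
    using 1[of \<one>] by simp
  show 2: "inv b \<otimes> (inv a \<otimes> (b \<otimes> (a \<otimes> (b \<otimes> x)))) = a \<otimes> x" if [simp]: "x \<in> carrier G" for x
    using braid'[of x] by (simp add: inv_cancel_left)
  show "inv b \<otimes> (inv a \<otimes> (b \<otimes> (a \<otimes> b))) = a"
    using 2[of \<one>] by simp
  show "inv b \<otimes> (inv a \<otimes> (inv b \<otimes> (a \<otimes> (b \<otimes> x)))) = inv a \<otimes> x" if [simp]: "x \<in> carrier G" for x
  proof -
    have "a \<otimes> (b \<otimes> x) = b \<otimes> (a \<otimes> (b \<otimes> (inv a \<otimes> x)))"
      by (simp add: braid' inv_cancel_left)
    then show ?thesis by (simp add: inv_cancel_left)
  qed
qed

text \<open>These are the third, fifth and fourth relations of \<open>G3\<close> after \<alpha>,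
  \<beta>, \<open>\<beta>b\<close> become b, a, c. The last has its inner a c already turned into c
  a, as rewriting with \<open>comm\<close> does.\<close>

lemma (in group) G0_identities:
  assumes [simp]: "a \<in> carrier G" "b \<in> carrier G" "c \<in> carrier G"
    and comm: "a \<otimes> c = c \<otimes> a"
    and ab: "a \<otimes> (b \<otimes> a) = b \<otimes> (a \<otimes> b)" and bc: "b \<otimes> (c \<otimes> b) = c \<otimes> (b \<otimes> c)"
    and w: "b \<otimes> (a \<otimes> (a \<otimes> (b \<otimes> (c \<otimes> c)))) = \<one>"
  shows "a \<otimes> (inv b \<otimes> (c \<otimes> (a \<otimes> (inv c \<otimes> (b \<otimes> inv a))))) =
      c \<otimes> (inv b \<otimes> (a \<otimes> (c \<otimes> (inv a \<otimes> (b \<otimes> inv c)))))"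
    and "b \<otimes> (c \<otimes> (a \<otimes> (c \<otimes> (inv a \<otimes> (b \<otimes> (a \<otimes> (c \<otimes> (a \<otimes> inv c)))))))) = \<one>"
    and "c \<otimes> (a \<otimes> (c \<otimes> a)) = a \<otimes> (c \<otimes> (c \<otimes> a))"
proof -
  have comm': "c \<otimes> (a \<otimes> x) = a \<otimes> (c \<otimes> x)" if "x \<in> carrier G" for x
    using arg_cong[OF comm, of "\<lambda>y. y \<otimes> x"] that by (simp add: m_assoc)
  show "c \<otimes> (a \<otimes> (c \<otimes> a)) = a \<otimes> (c \<otimes> (c \<otimes> a))"
    by (simp add: comm')
  have ca: "c \<otimes> (a \<otimes> inv c) = a" using comm'[of "inv c"] by simp
  have ac: "a \<otimes> (c \<otimes> inv a) = c" using comm'[of "inv a"] by simp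
  have ca': "c \<otimes> (a \<otimes> (inv c \<otimes> x)) = a \<otimes> x" if "x \<in> carrier G" for x
    using comm'[of "inv c \<otimes> x"] that by (simp add: inv_cancel_left)
  have ac': "a \<otimes> (c \<otimes> (inv a \<otimes> x)) = c \<otimes> x" if "x \<in> carrier G" for x
    using comm'[of "inv a \<otimes> x"] that by (simp add: inv_cancel_left)
  \<comment> \<open>The braid relation of \<open>x\<close> and \<open>b\<close> in the form b^-1 x b
    = x b x^-1, with a tail \<open>y\<close>.\<close>
  have conj: "inv b \<otimes> (x \<otimes> (b \<otimes> y)) = x \<otimes> (b \<otimes> (inv x \<otimes> y))"
    if braid: "x \<otimes> (b \<otimes> x) = b \<otimes> (x \<otimes> b)" and [simp]: "x \<in> carrier G" "y \<in> carrier G" for x y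
  proof -
    have "b \<otimes> (x \<otimes> (b \<otimes> (inv x \<otimes> y))) = x \<otimes> (b \<otimes> y)"
      using arg_cong[OF braid, of "\<lambda>z. z \<otimes> (inv x \<otimes> y)"] by (simp add: m_assoc inv_cancel_left)
    then have "inv b \<otimes> (x \<otimes> (b \<otimes> y)) = inv b \<otimes> (b \<otimes> (x \<otimes> (b \<otimes> (inv x \<otimes> y))))" by simp
    then show ?thesis by (simp add: inv_cancel_left)
  qed
  have w1: "a \<otimes> (a \<otimes> (b \<otimes> (c \<otimes> c))) = inv b"
    by (rule inv_equality[OF inv_comm[OF w], symmetric]) simp_all
  have w': "b \<otimes> (c \<otimes> (c \<otimes> (b \<otimes> (a \<otimes> a)))) = \<one>"
    using inv_comm[of "b \<otimes> (a \<otimes> a)" "b \<otimes> (c \<otimes> c)"] w by (simp add: m_assoc)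
  have w2: "c \<otimes> (c \<otimes> (b \<otimes> (a \<otimes> a))) = inv b"
    by (rule inv_equality[OF inv_comm[OF w'], symmetric]) simp_all
  show "b \<otimes> (c \<otimes> (a \<otimes> (c \<otimes> (inv a \<otimes> (b \<otimes> (a \<otimes> (c \<otimes> (a \<otimes> inv c)))))))) = \<one>"
    using w' by (simp add: ca ac')
  \<comment> \<open>After commuting a with c and applying \<open>conj\<close>, the first claim reads
    a^2 b a^-2 = c^2 b c^-2. Multiplied on the right by a^2 c^2, both sides become b^-1, by
    \<open>w1\<close> and \<open>w2\<close>.\<close>
  have "a \<otimes> (a \<otimes> (b \<otimes> (inv a \<otimes> inv a))) = c \<otimes> (c \<otimes> (b \<otimes> (inv c \<otimes> inv c)))"
  proof -
    have "a \<otimes> (a \<otimes> (b \<otimes> (inv a \<otimes> inv a))) \<otimes> (a \<otimes> a \<otimes> (c \<otimes> c)) = inv b"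
      by (simp add: m_assoc inv_cancel_left w1)
    moreover have "c \<otimes> (c \<otimes> (b \<otimes> (inv c \<otimes> inv c))) \<otimes> (a \<otimes> a \<otimes> (c \<otimes> c)) = inv b"
    proof -
      have "a \<otimes> a \<otimes> (c \<otimes> c) = c \<otimes> (c \<otimes> (a \<otimes> a))"
        by (simp add: m_assoc comm' flip: comm)
      then show ?thesis by (simp add: m_assoc inv_cancel_left w2)
    qed
    ultimately have "a \<otimes> (a \<otimes> (b \<otimes> (inv a \<otimes> inv a))) \<otimes> (a \<otimes> a \<otimes> (c \<otimes> c)) =
        c \<otimes> (c \<otimes> (b \<otimes> (inv c \<otimes> inv c))) \<otimes> (a \<otimes> a \<otimes> (c \<otimes> c))"
      by (simp only:)
    then show ?thesis
      by (rule right_cancel[THEN iffD1, rotated 3]) (intro m_closed inv_closed assms(1-3))+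
  qed
  then show "a \<otimes> (inv b \<otimes> (c \<otimes> (a \<otimes> (inv c \<otimes> (b \<otimes> inv a))))) =
      c \<otimes> (inv b \<otimes> (a \<otimes> (c \<otimes> (inv a \<otimes> (b \<otimes> inv c)))))"
    by (simp add: ca' ac' conj ab bc)
qed

section \<open>Explicit presentations of the two braid quotients\<close>

lemma wpow_2: "wpow w 2 = w @ w"
  by (simp add: wpow_def numeral_2_eq_2)

lemma wpow_3: "wpow w 3 = w @ w @ w"
  by (simp add: wpow_def numeral_3_eq_3)

lemma strings_3: "{1..<3::nat} = {1, 2}"
  by auto

lemma strings_4: "{1..<4::nat} = {1, 2, 3}"
  by auto

lemma braid_relations_3:
  "braid_relations 3 = {(gen 1 @ gen 2 @ gen 1, gen 2 @ gen 1 @ gen 2)}"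
proof -
  have 1: "(i \<in> {1..<3::nat} \<and> j \<in> {1..<3} \<and> i + 2 \<le> j) = False" for i j
    by auto
  have 2: "(i \<in> {1..<3::nat} \<and> i + 1 \<in> {1..<3}) = (i = 1)" for i
    by auto
  show ?thesis
    unfolding braid_relations_def 1 2 by simp
qed

lemma braid_relations_4:
  "braid_relations 4 = {(gen 1 @ gen 3, gen 3 @ gen 1),
     (gen 1 @ gen 2 @ gen 1, gen 2 @ gen 1 @ gen 2),
     (gen 2 @ gen 3 @ gen 2, gen 3 @ gen 2 @ gen 3)}"
proof -
  have 1: "(i \<in> {1..<4::nat} \<and> j \<in> {1..<4} \<and> i + 2 \<le> j) = (i = 1 \<and> j = 3)" for i j
    by auto
  have 2: "(i \<in> {1..<4::nat} \<and> i + 1 \<in> {1..<4}) = (i = 1 \<or> i = 2)" for i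
    by auto
  have 3: "{f i | i. i = 1 \<or> i = 2} = {f 1, f 2}" for f :: "nat \<Rightarrow> nat word \<times> nat word"
    by auto
  show ?thesis
    unfolding braid_relations_def 1 2 3 by (simp add: insert_commute)
qed

lemma presentation_braid: "presentation {1..<n} (braid_relations n)"
  by unfold_locales (auto simp: braid_relations_def gen_def)

lemma braid_quotient_iso:
  assumes "w \<in> words {1..<n}"
  shows "braid_quotient n w \<cong> presented_group {1..<n} (insert (w, []) (braid_relations n))"
  unfolding braid_quotient_def braid_group_def
  by (rule presentation.Mod_normal_closure_iso[OF presentation_braid assms])

definition B3q_relations :: "(nat word \<times> nat word) set" where
  "B3q_relations = {(wpow (gen 1 @ gen 2) 3, []), (gen 1 @ gen 2 @ gen 1, gen 2 @ gen 1 @ gen 2)}"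

definition G0_relations :: "(nat word \<times> nat word) set" where
  "G0_relations = {(gen 2 @ gen 1 @ gen 1 @ gen 2 @ gen 3 @ gen 3, []),
     (gen 1 @ gen 3, gen 3 @ gen 1),
     (gen 1 @ gen 2 @ gen 1, gen 2 @ gen 1 @ gen 2),
     (gen 2 @ gen 3 @ gen 2, gen 3 @ gen 2 @ gen 3)}"

lemma B3_quotient_iso: "B3_quotient \<cong> presented_group {1, 2} B3q_relations"
  using braid_quotient_iso[of "wpow (gen 1 @ gen 2) 3" 3]
  by (simp add: wpow_in_words B3_quotient_def B3q_relations_def braid_relations_3 strings_3)

lemma G0_iso: "G0 \<cong> presented_group {1, 2, 3} G0_relations"
  using braid_quotient_iso[of "gen 2 @ gen 1 @ gen 1 @ gen 2 @ gen 3 @ gen 3" 4]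
  by (simp add: G0_def G0_relations_def braid_relations_4 strings_4)

interpretation B3q: presentation "{1, 2}" B3q_relations
  by unfold_locales (simp add: B3q_relations_def wpow_in_words)

interpretation G0: presentation "{1, 2, 3}" G0_relations
  by unfold_locales (simp add: G0_relations_def)

text \<open>An opaque name for the class of a generator: it shields \<open>gen\<close> from being
  unfolded by \<open>word_simps\<close>, so that the group identities still match.
  \<open>G0_gen\<close> serves the same purpose.\<close>

definition B3q_gen :: "nat \<Rightarrow> nat word set" where
  "B3q_gen i = B3q.cls (gen i)"

definition G0_gen :: "nat \<Rightarrow> nat word set" where
  "G0_gen i = G0.cls (gen i)"

lemma B3q_gen_identities:
  defines "a \<equiv> B3q_gen 1" and "b \<equiv> B3q_gen 2"
  shows "a \<in> carrier B3q.P" "b \<in> carrier B3q.P"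
    and "a \<otimes>\<^bsub>B3q.P\<^esub> (b \<otimes>\<^bsub>B3q.P\<^esub> a) = b \<otimes>\<^bsub>B3q.P\<^esub> (a \<otimes>\<^bsub>B3q.P\<^esub> b)"
    and "a \<otimes>\<^bsub>B3q.P\<^esub> (b \<otimes>\<^bsub>B3q.P\<^esub> (a \<otimes>\<^bsub>B3q.P\<^esub> (b \<otimes>\<^bsub>B3q.P\<^esub> (a \<otimes>\<^bsub>B3q.P\<^esub> b)))) = \<one>\<^bsub>B3q.P\<^esub>"
proof -
  have "(gen 1 @ gen 2 @ gen 1, gen 2 @ gen 1 @ gen 2) \<in> B3q_relations"
    "(wpow (gen 1 @ gen 2) 3, []) \<in> B3q_relations"
    by (simp_all add: B3q_relations_def)
  from this[THEN B3q.cls_relation] show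
    "a \<otimes>\<^bsub>B3q.P\<^esub> (b \<otimes>\<^bsub>B3q.P\<^esub> a) = b \<otimes>\<^bsub>B3q.P\<^esub> (a \<otimes>\<^bsub>B3q.P\<^esub> b)"
    "a \<otimes>\<^bsub>B3q.P\<^esub> (b \<otimes>\<^bsub>B3q.P\<^esub> (a \<otimes>\<^bsub>B3q.P\<^esub> (b \<otimes>\<^bsub>B3q.P\<^esub> (a \<otimes>\<^bsub>B3q.P\<^esub> b)))) = \<one>\<^bsub>B3q.P\<^esub>"
    unfolding a_def b_def B3q_gen_def by (simp_all add: B3q.cls_append B3q.one_P wpow_3)
qed (simp_all add: a_def b_def B3q_gen_def)

lemma G0_gen_identities:
  defines "a \<equiv> G0_gen 1" and "b \<equiv> G0_gen 2" and "c \<equiv> G0_gen 3"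
  shows "a \<in> carrier G0.P" "b \<in> carrier G0.P" "c \<in> carrier G0.P"
    and "a \<otimes>\<^bsub>G0.P\<^esub> c = c \<otimes>\<^bsub>G0.P\<^esub> a"
    and "a \<otimes>\<^bsub>G0.P\<^esub> (b \<otimes>\<^bsub>G0.P\<^esub> a) = b \<otimes>\<^bsub>G0.P\<^esub> (a \<otimes>\<^bsub>G0.P\<^esub> b)"
    and "b \<otimes>\<^bsub>G0.P\<^esub> (c \<otimes>\<^bsub>G0.P\<^esub> b) = c \<otimes>\<^bsub>G0.P\<^esub> (b \<otimes>\<^bsub>G0.P\<^esub> c)"
    and "b \<otimes>\<^bsub>G0.P\<^esub> (a \<otimes>\<^bsub>G0.P\<^esub> (a \<otimes>\<^bsub>G0.P\<^esub> (b \<otimes>\<^bsub>G0.P\<^esub> (c \<otimes>\<^bsub>G0.P\<^esub> c)))) = \<one>\<^bsub>G0.P\<^esub>"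
proof -
  have "(gen 1 @ gen 3, gen 3 @ gen 1) \<in> G0_relations"
    "(gen 1 @ gen 2 @ gen 1, gen 2 @ gen 1 @ gen 2) \<in> G0_relations"
    "(gen 2 @ gen 3 @ gen 2, gen 3 @ gen 2 @ gen 3) \<in> G0_relations"
    "(gen 2 @ gen 1 @ gen 1 @ gen 2 @ gen 3 @ gen 3, []) \<in> G0_relations"
    by (simp_all add: G0_relations_def)
  from this[THEN G0.cls_relation] show
    "a \<otimes>\<^bsub>G0.P\<^esub> c = c \<otimes>\<^bsub>G0.P\<^esub> a"
    "a \<otimes>\<^bsub>G0.P\<^esub> (b \<otimes>\<^bsub>G0.P\<^esub> a) = b \<otimes>\<^bsub>G0.P\<^esub> (a \<otimes>\<^bsub>G0.P\<^esub> b)"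
    "b \<otimes>\<^bsub>G0.P\<^esub> (c \<otimes>\<^bsub>G0.P\<^esub> b) = c \<otimes>\<^bsub>G0.P\<^esub> (b \<otimes>\<^bsub>G0.P\<^esub> c)"
    "b \<otimes>\<^bsub>G0.P\<^esub> (a \<otimes>\<^bsub>G0.P\<^esub> (a \<otimes>\<^bsub>G0.P\<^esub> (b \<otimes>\<^bsub>G0.P\<^esub> (c \<otimes>\<^bsub>G0.P\<^esub> c)))) = \<one>\<^bsub>G0.P\<^esub>"
    unfolding a_def b_def c_def G0_gen_def by (simp_all add: G0.cls_append G0.one_P)
qed (simp_all add: a_def b_def c_def G0_gen_def)

section \<open>The groups of the sextics\<close>

text \<open>The permutations below were found by a computer search. In each case two words that the
  renaming of generators \<open>m\<close> identifies act differently.\<close>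

lemmas word_simps = gen_def winv_def wpow_2 wpow_3

lemmas sym_group_eval =
  sym_group_mult sym_group_one perm_of_comp perm_of_eq_iff perm_of_id

lemmas B3q_eval =
  B3q.P.inv_cancel_left B3q_gen_identities
  B3q.P.B3_quotient_identities[OF B3q_gen_identities]

lemmas G0_eval =
  G0_gen_identities G0.P.G0_identities[OF G0_gen_identities]

lemmas G0_perms =
  perm_of_inv[of "[2, 1, 3, 4]" 4 "[2, 1, 3, 4]", unfolded upt_4, simplified]
  perm_of_inv[of "[1, 3, 2, 4]" 4 "[1, 3, 2, 4]", unfolded upt_4, simplified]
  perm_of_inv[of "[1, 2, 4, 3]" 4 "[1, 2, 4, 3]", unfolded upt_4, simplified]

text \<open>The renaming is the classical epimorphism of braid groups from four to three strings
  with \<sigma>_3 sent to \<sigma>_1; it turns the relator of \<open>G0\<close> into a full twist.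
  \<open>f\<close> sends \<sigma>_i to the transposition (i, i+1). The relator dies because
  transpositions are involutions, yet \<sigma>_1 and \<sigma>_3 have different images.\<close>

lemma G0_not_iso_B3q: "\<not> G0.P \<cong> B3q.P"
proof (rule presented_groups_not_iso[where m = "\<lambda>i. [1, 2, 1] ! (i - 1)" and K = "sym_group 4" and
      f = "\<lambda>i. perm_of ([[2, 1, 3, 4], [1, 3, 2, 4], [1, 2, 4, 3]] ! (i - 1))" and p = "gen 1" and q = "gen 3"])
  let ?m = "\<lambda>i. [1, 2, 1] ! (i - 1)"
  let ?f = "\<lambda>i. perm_of ([[2, 1, 3, 4], [1, 3, 2, 4], [1, 2, 4, 3]] ! (i - 1))"
  show "\<forall>(u, v)\<in>G0_relations. word_eval B3q.P (\<lambda>i. B3q.cls (gen (?m i))) u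
      = word_eval B3q.P (\<lambda>i. B3q.cls (gen (?m i))) v"
    unfolding B3q_gen_def[symmetric]
    by (simp add: G0_relations_def Let_def word_simps nth_Cons' B3q_eval)
  show "word_eval B3q.P (\<lambda>i. B3q.cls (gen (?m i))) (gen 1)
      = word_eval B3q.P (\<lambda>i. B3q.cls (gen (?m i))) (gen 3)"
    unfolding B3q_gen_def[symmetric]
    by (simp add: Let_def word_simps nth_Cons' B3q_eval)
  show "?f \<in> {1, 2, 3} \<rightarrow> carrier (sym_group 4)"
    by (simp add: nth_Cons' G0_perms)
  show "\<forall>(u, v)\<in>G0_relations. word_eval (sym_group 4) ?f u = word_eval (sym_group 4) ?f v"
    by (simp add: G0_relations_def Let_def word_simps nth_Cons' sym_group_eval G0_perms)
  show "word_eval (sym_group 4) ?f (gen 1) \<noteq> word_eval (sym_group 4) ?f (gen 3)"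
    by (simp add: Let_def word_simps nth_Cons' sym_group_eval G0_perms)
qed (auto simp: G0.presentation_axioms B3q.presentation_axioms sym_group_is_group finite_sym_group nth_Cons' word_simps)

section \<open>The groups G_3, G_2' and G_2'' compared with their targets\<close>

definition G3_relations :: "(nat word \<times> nat word) set" where
  "G3_relations =
    (let \<alpha> = gen 0; \<beta> = gen 1; \<beta>b = gen 2 in
      {(\<alpha> @ \<beta> @ \<alpha>, \<beta> @ \<alpha> @ \<beta>),
       (\<alpha> @ \<beta>b @ \<alpha>, \<beta>b @ \<alpha> @ \<beta>b),
       (\<beta> @ winv \<alpha> @ \<beta>b @ \<beta> @ winv \<beta>b @ \<alpha> @ winv \<beta>,
        \<beta>b @ winv \<alpha> @ \<beta> @ \<beta>b @ winv \<beta> @ \<alpha> @ winv \<beta>b),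
       (wpow (\<beta>b @ \<beta>) 2, wpow (\<beta> @ \<beta>b) 2),
       (\<alpha> @ \<beta>b @ \<beta> @ \<beta>b @ winv \<beta> @ \<alpha> @ \<beta> @ \<beta>b @ \<beta> @ winv \<beta>b, [])})"

definition G2'_relations :: "(nat word \<times> nat word) set" where
  "G2'_relations =
    (let \<alpha> = gen 0; \<beta> = gen 1;
         \<alpha>b = winv (\<alpha> @ \<beta>) @ \<beta> @ (\<alpha> @ \<beta>);
         \<beta>b = (\<alpha> @ \<beta>) @ \<alpha> @ winv (\<alpha> @ \<beta>) in
      {(wpow (\<alpha> @ \<beta>) 3, wpow (\<beta> @ \<alpha>) 3),
       (\<beta>b @ \<beta> @ \<beta>b, \<beta> @ \<beta>b @ \<beta>),
       (\<alpha> @ \<beta>b @ \<beta> @ \<alpha>b @ \<beta> @ \<beta>b, []),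
       (winv \<alpha> @ \<beta> @ \<beta>b @ winv \<beta> @ \<alpha>, winv \<alpha>b @ \<beta>b @ \<beta> @ winv \<beta>b @ \<alpha>b)})"

definition G2''_relations :: "(nat word \<times> nat word) set" where
  "G2''_relations =
    (let \<alpha> = gen 0; \<beta> = gen 1; \<gamma> = gen 2; \<gamma>b = gen 3;
         \<alpha>b = winv (\<alpha> @ \<beta>) @ \<beta> @ (\<alpha> @ \<beta>);
         \<beta>b = (\<alpha> @ \<beta>) @ \<alpha> @ winv (\<alpha> @ \<beta>) in
      {(wpow (\<alpha> @ \<beta>) 3, wpow (\<beta> @ \<alpha>) 3),
       (\<alpha> @ \<beta> @ \<gamma>b @ \<alpha> @ \<beta> @ \<gamma>, []),
       (\<gamma> @ \<gamma>b @ \<gamma>, \<gamma>b @ \<gamma> @ \<gamma>b),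
       (\<gamma>b @ \<gamma> @ winv \<gamma>b, \<beta>),
       (\<gamma> @ \<gamma>b @ winv \<gamma>, \<beta>b),
       (\<gamma> @ \<alpha> @ winv \<gamma>, \<gamma>b @ \<alpha>b @ winv \<gamma>b)})"

lemma G3_eq: "G3 = presented_group {0, 1, 2} G3_relations"
  by (simp add: G3_def G3_relations_def Let_def)

lemma G2'_eq: "G2' = presented_group {0, 1} G2'_relations"
  by (simp add: G2'_def G2'_relations_def Let_def)

lemma G2''_eq: "G2'' = presented_group {0, 1, 2, 3} G2''_relations"
  by (simp add: G2''_def G2''_relations_def Let_def)

interpretation G3: presentation "{0, 1, 2}" G3_relations
  by unfold_locales (simp add: G3_relations_def Let_def wpow_in_words)

interpretation G2': presentation "{0, 1}" G2'_relations
  by unfold_locales (simp add: G2'_relations_def Let_def wpow_in_words)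

interpretation G2'': presentation "{0, 1, 2, 3}" G2''_relations
  by unfold_locales (simp add: G2''_relations_def Let_def wpow_in_words)

lemmas G3_perms =
  perm_of_inv[of "[1, 2, 4, 3, 6, 5, 8, 7]" 8 "[1, 2, 4, 3, 6, 5, 8, 7]", unfolded upt_8, simplified]
  perm_of_inv[of "[1, 2, 5, 7, 3, 8, 4, 6]" 8 "[1, 2, 5, 7, 3, 8, 4, 6]", unfolded upt_8, simplified]
  perm_of_inv[of "[3, 5, 1, 4, 2, 6, 8, 7]" 8 "[3, 5, 1, 4, 2, 6, 8, 7]", unfolded upt_8, simplified]

text \<open>\<alpha>, \<beta>, \<open>\<beta>b\<close> go to \<sigma>_2, \<sigma>_1, \<sigma>_3, so
  \<beta> and \<open>\<beta>b\<close> commute in the target. In degree 8 they go to involutions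
  whose product has order 4: these do not commute, but satisfy the relation on squares.\<close>

lemma G3_not_iso_G0: "\<not> G3.P \<cong> G0.P"
proof (rule presented_groups_not_iso[where m = "\<lambda>i. [2, 1, 3] ! i" and K = "sym_group 8" and
      f = "\<lambda>i. perm_of ([[1, 2, 4, 3, 6, 5, 8, 7],
      [1, 2, 5, 7, 3, 8, 4, 6],
      [3, 5, 1, 4, 2, 6, 8, 7]] ! i)" and p = "gen 1 @ gen 2" and q = "gen 2 @ gen 1"])
  let ?m = "\<lambda>i. [2, 1, 3] ! i"
  let ?f = "\<lambda>i. perm_of ([[1, 2, 4, 3, 6, 5, 8, 7],
      [1, 2, 5, 7, 3, 8, 4, 6],
      [3, 5, 1, 4, 2, 6, 8, 7]] ! i)"
  show "\<forall>(u, v)\<in>G3_relations. word_eval G0.P (\<lambda>i. G0.cls (gen (?m i))) u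
      = word_eval G0.P (\<lambda>i. G0.cls (gen (?m i))) v"
    unfolding G0_gen_def[symmetric]
    by (simp add: G3_relations_def Let_def word_simps nth_Cons' G0_eval)
  show "word_eval G0.P (\<lambda>i. G0.cls (gen (?m i))) (gen 1 @ gen 2)
      = word_eval G0.P (\<lambda>i. G0.cls (gen (?m i))) (gen 2 @ gen 1)"
    unfolding G0_gen_def[symmetric]
    by (simp add: Let_def word_simps nth_Cons' G0_eval)
  show "?f \<in> {0, 1, 2} \<rightarrow> carrier (sym_group 8)"
    by (simp add: nth_Cons' G3_perms)
  show "\<forall>(u, v)\<in>G3_relations. word_eval (sym_group 8) ?f u = word_eval (sym_group 8) ?f v"
    by (simp add: G3_relations_def Let_def word_simps nth_Cons' sym_group_eval G3_perms)
  show "word_eval (sym_group 8) ?f (gen 1 @ gen 2) \<noteq> word_eval (sym_group 8) ?f (gen 2 @ gen 1)"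
    by (simp add: Let_def word_simps nth_Cons' sym_group_eval G3_perms)
qed (auto simp: G3.presentation_axioms G0.presentation_axioms sym_group_is_group finite_sym_group nth_Cons' word_simps)

lemmas G2'_perms =
  perm_of_inv[of "[1, 2, 4, 5, 6, 7, 8, 3]" 8 "[1, 2, 8, 3, 4, 5, 6, 7]", unfolded upt_8, simplified]
  perm_of_inv[of "[3, 6, 5, 4, 2, 8, 7, 1]" 8 "[8, 5, 1, 4, 3, 2, 7, 6]", unfolded upt_8, simplified]

text \<open>The word \<open>p\<close> spells \<open>\<beta>b\<close>, which the braid relation of
  the target makes equal to \<beta>. Sending \<alpha> and \<beta> to two 6-cycles keeps them
  apart.\<close>

lemma G2'_not_iso_B3q: "\<not> G2'.P \<cong> B3q.P"
proof (rule presented_groups_not_iso[where m = "\<lambda>i. [1, 2] ! i" and K = "sym_group 8" and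
      f = "\<lambda>i. perm_of ([[1, 2, 4, 5, 6, 7, 8, 3],
      [3, 6, 5, 4, 2, 8, 7, 1]] ! i)" and p = "(gen 0 @ gen 1) @ gen 0 @ winv (gen 0 @ gen 1)" and q = "gen 1"])
  let ?m = "\<lambda>i. [1, 2] ! i"
  let ?f = "\<lambda>i. perm_of ([[1, 2, 4, 5, 6, 7, 8, 3],
      [3, 6, 5, 4, 2, 8, 7, 1]] ! i)"
  show "\<forall>(u, v)\<in>G2'_relations. word_eval B3q.P (\<lambda>i. B3q.cls (gen (?m i))) u
      = word_eval B3q.P (\<lambda>i. B3q.cls (gen (?m i))) v"
    unfolding B3q_gen_def[symmetric]
    by (simp add: G2'_relations_def Let_def word_simps nth_Cons' B3q_eval)
  show "word_eval B3q.P (\<lambda>i. B3q.cls (gen (?m i))) ((gen 0 @ gen 1) @ gen 0 @ winv (gen 0 @ gen 1))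
      = word_eval B3q.P (\<lambda>i. B3q.cls (gen (?m i))) (gen 1)"
    unfolding B3q_gen_def[symmetric]
    by (simp add: Let_def word_simps nth_Cons' B3q_eval)
  show "?f \<in> {0, 1} \<rightarrow> carrier (sym_group 8)"
    by (simp add: nth_Cons' G2'_perms)
  show "\<forall>(u, v)\<in>G2'_relations. word_eval (sym_group 8) ?f u = word_eval (sym_group 8) ?f v"
    by (simp add: G2'_relations_def Let_def word_simps nth_Cons' sym_group_eval G2'_perms)
  show "word_eval (sym_group 8) ?f ((gen 0 @ gen 1) @ gen 0 @ winv (gen 0 @ gen 1)) \<noteq> word_eval (sym_group 8) ?f (gen 1)"
    by (simp add: Let_def word_simps nth_Cons' sym_group_eval G2'_perms)
qed (auto simp: G2'.presentation_axioms B3q.presentation_axioms sym_group_is_group finite_sym_group nth_Cons' word_simps)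

lemmas G2''_perms =
  perm_of_inv[of "[1, 2, 4, 5, 6, 7, 8, 3]" 8 "[1, 2, 8, 3, 4, 5, 6, 7]", unfolded upt_8, simplified]
  perm_of_inv[of "[3, 6, 5, 4, 2, 8, 7, 1]" 8 "[8, 5, 1, 4, 3, 2, 7, 6]", unfolded upt_8, simplified]
  perm_of_inv[of "[6, 3, 5, 4, 1, 8, 7, 2]" 8 "[5, 8, 2, 4, 3, 1, 7, 6]", unfolded upt_8, simplified]
  perm_of_inv[of "[3, 6, 8, 4, 1, 5, 7, 2]" 8 "[5, 8, 1, 4, 6, 2, 7, 3]", unfolded upt_8, simplified]

text \<open>The renaming merges \<beta>, \<gamma> and \<open>\<gamma>b\<close>. The permutations for
  \<alpha> and \<beta> are those used for \<open>G2'\<close>; \<gamma> and \<open>\<gamma>b\<close>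
  go to distinct 6-cycles.\<close>

lemma G2''_not_iso_B3q: "\<not> G2''.P \<cong> B3q.P"
proof (rule presented_groups_not_iso[where m = "\<lambda>i. [1, 2, 2, 2] ! i" and K = "sym_group 8" and
      f = "\<lambda>i. perm_of ([[1, 2, 4, 5, 6, 7, 8, 3],
      [3, 6, 5, 4, 2, 8, 7, 1],
      [6, 3, 5, 4, 1, 8, 7, 2],
      [3, 6, 8, 4, 1, 5, 7, 2]] ! i)" and p = "gen 2" and q = "gen 3"])
  let ?m = "\<lambda>i. [1, 2, 2, 2] ! i"
  let ?f = "\<lambda>i. perm_of ([[1, 2, 4, 5, 6, 7, 8, 3],
      [3, 6, 5, 4, 2, 8, 7, 1],
      [6, 3, 5, 4, 1, 8, 7, 2],
      [3, 6, 8, 4, 1, 5, 7, 2]] ! i)"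
  show "\<forall>(u, v)\<in>G2''_relations. word_eval B3q.P (\<lambda>i. B3q.cls (gen (?m i))) u
      = word_eval B3q.P (\<lambda>i. B3q.cls (gen (?m i))) v"
    unfolding B3q_gen_def[symmetric]
    by (simp add: G2''_relations_def Let_def word_simps nth_Cons' B3q_eval)
  show "word_eval B3q.P (\<lambda>i. B3q.cls (gen (?m i))) (gen 2)
      = word_eval B3q.P (\<lambda>i. B3q.cls (gen (?m i))) (gen 3)"
    unfolding B3q_gen_def[symmetric]
    by (simp add: Let_def word_simps nth_Cons' B3q_eval)
  show "?f \<in> {0, 1, 2, 3} \<rightarrow> carrier (sym_group 8)"
    by (simp add: nth_Cons' G2''_perms)
  show "\<forall>(u, v)\<in>G2''_relations. word_eval (sym_group 8) ?f u = word_eval (sym_group 8) ?f v"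
    by (simp add: G2''_relations_def Let_def word_simps nth_Cons' sym_group_eval G2''_perms)
  show "word_eval (sym_group 8) ?f (gen 2) \<noteq> word_eval (sym_group 8) ?f (gen 3)"
    by (simp add: Let_def word_simps nth_Cons' sym_group_eval G2''_perms)
qed (auto simp: G2''.presentation_axioms B3q.presentation_axioms sym_group_is_group finite_sym_group nth_Cons' word_simps)

section \<open>Fundamental groups\<close>

lemma loop_class_cong: "homotopic_paths S p q \<Longrightarrow> loop_class S p = loop_class S q"
  unfolding loop_class_def by (blast intro: homotopic_paths_sym homotopic_paths_trans)

lemma fundamental_group_mult_closed:
  assumes "A \<in> carrier (fundamental_group S x)" "B \<in> carrier (fundamental_group S x)"
  shows "A \<otimes>\<^bsub>fundamental_group S x\<^esub> B \<in> carrier (fundamental_group S x)"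
proof -
  obtain p q where p: "p \<in> loops S x" "A = loop_class S p" and q: "q \<in> loops S x" "B = loop_class S q"
    using assms by (auto simp: fundamental_group_def)
  have mem: "p \<in> A" "q \<in> B"
    using p q by (auto simp: loop_class_def loops_def)
  have "loop_class S (p' +++ q') = loop_class S (p +++ q)" if "p' \<in> A" "q' \<in> B" for p' q'
  proof (rule loop_class_cong[symmetric])
    have "pathfinish p = pathstart q" using p q by (simp add: loops_def)
    then show "homotopic_paths S (p +++ q) (p' +++ q')"
      using that p q by (intro homotopic_paths_join) (auto simp: loop_class_def)
  qed
  then have "(\<Union>p'\<in>A. \<Union>q'\<in>B. loop_class S (p' +++ q')) = loop_class S (p +++ q)"
    using mem by blast
  moreover have "p +++ q \<in> loops S x"
    using p q by (auto simp: loops_def path_image_join)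
  ultimately show ?thesis by (simp add: fundamental_group_def)
qed

text \<open>Closure puts the product of two preimages in the carrier, where \<open>f\<close> is
  injective, so the inverse map is multiplicative. This reverses an isomorphism out of a curve group
  by closure of its multiplication alone.\<close>

lemma iso_symmetric:
  assumes "G \<cong> H" and closed: "\<And>x y. x \<in> carrier G \<Longrightarrow> y \<in> carrier G \<Longrightarrow> x \<otimes>\<^bsub>G\<^esub> y \<in> carrier G"
  shows "H \<cong> G"
proof -
  obtain f where f: "f \<in> hom G H" "bij_betw f (carrier G) (carrier H)"
    using assms(1) by (auto simp: is_iso_def iso_def)
  let ?g = "inv_into (carrier G) f"
  have g: "?g y \<in> carrier G" "f (?g y) = y" if "y \<in> carrier H" for y
    using f(2) that by (auto simp: bij_betw_def inv_into_into f_inv_into_f)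
  have "?g \<in> hom H G"
  proof (rule homI)
    fix x y assume xy: "x \<in> carrier H" "y \<in> carrier H"
    have "f (?g x \<otimes>\<^bsub>G\<^esub> ?g y) = x \<otimes>\<^bsub>H\<^esub> y"
      using hom_mult[OF f(1) g(1)[OF xy(1)] g(1)[OF xy(2)]] g(2) xy by simp
    then show "?g (x \<otimes>\<^bsub>H\<^esub> y) = ?g x \<otimes>\<^bsub>G\<^esub> ?g y"
      using f(2) closed[OF g(1)[OF xy(1)] g(1)[OF xy(2)]]
      by (metis bij_betw_imp_inj_on inv_into_f_f)
  qed (rule g(1))
  then show ?thesis
    using bij_betw_inv_into[OF f(2)] by (auto simp: is_iso_def iso_def)
qed

lemma curve_group_iso_transfer:
  assumes "curve_group F x \<cong> curve_group F' x'" "curve_group F x \<cong> H" "curve_group F' x' \<cong> K"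
  shows "H \<cong> K"
proof -
  have "H \<cong> curve_group F x"
    using assms(2) fundamental_group_mult_closed unfolding curve_group_def by (rule iso_symmetric)
  then show ?thesis by (rule iso_trans[OF iso_trans[OF _ assms(1)] assms(3)])
qed

theorem theorem1p1p4:
  fixes F F' :: "complex^3 \<Rightarrow> complex" and T :: "cp2 set" and x :: cp2
  assumes "torus_sextic_2E6 F" and "torus_sextic_2E6 F'"
    and "small_perturbation F T F'" and "x \<notin> T"
    and "curve_group F x \<cong> G3 \<and> curve_group F' x \<cong> G0 \<or>
         curve_group F x \<cong> G0 \<and> curve_group F' x \<cong> B3_quotient \<or>
         curve_group F x \<cong> G2' \<and> curve_group F' x \<cong> B3_quotient \<or>
         curve_group F x \<cong> G2'' \<and> curve_group F' x \<cong> B3_quotient"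
  shows "perturbation_epi F T F' x \<notin> iso (curve_group F x) (curve_group F' x)"
proof
  assume "perturbation_epi F T F' x \<in> iso (curve_group F x) (curve_group F' x)"
  \<comment> \<open>Only the abstract isomorphism is kept. In each of the four cases it transfers to
    the two presented groups, which have been shown not to be isomorphic.\<close>
  then have iso: "curve_group F x \<cong> curve_group F' x" by (auto simp: is_iso_def)
  note transfer = curve_group_iso_transfer[OF iso]
  from assms(5) show False
  proof (elim disjE conjE)
    assume 1: "curve_group F x \<cong> G3" and 2: "curve_group F' x \<cong> G0"
    show False
      by (rule notE[OF G3_not_iso_G0 transfer[OF 1[unfolded G3_eq] iso_trans[OF 2 G0_iso]]])
  next
    assume 1: "curve_group F x \<cong> G0" and 2: "curve_group F' x \<cong> B3_quotient"
    show False
      by (rule notE[OF G0_not_iso_B3q transfer[OF iso_trans[OF 1 G0_iso] iso_trans[OF 2 B3_quotient_iso]]])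
  next
    assume 1: "curve_group F x \<cong> G2'" and 2: "curve_group F' x \<cong> B3_quotient"
    show False
      by (rule notE[OF G2'_not_iso_B3q transfer[OF 1[unfolded G2'_eq] iso_trans[OF 2 B3_quotient_iso]]])
  next
    assume 1: "curve_group F x \<cong> G2''" and 2: "curve_group F' x \<cong> B3_quotient"
    show False
      by (rule notE[OF G2''_not_iso_B3q transfer[OF 1[unfolded G2''_eq] iso_trans[OF 2 B3_quotient_iso]]])
  qed
qed

end
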